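(* For any $3$-regular graph $G$ on $n$ vertices, $\lfloor\frac{n}{4}\rfloor+4$ cops suffice to catch the robber; that is, $\mathrm{ent}(G)\le\lfloor\frac{n}{4}\rfloor+4$.
   Context: Graphs here are finite, simple and undirected. Entanglement game on a graph $G$ with $k$ cops: First the robber chooses a starting vertex, and all $k$ cops are outside the graph. In every turn, the cops either all stay where they are, or exactly one of them flies (from wherever it is, on or off the graph) to the current position of the robber. Regardless of which of these happened, the robber then has to move to a neighbor of his current position that is not occupied by a cop. If there is no such neighbor, the cops win. The robber wins if he can run away indefinitely. Both sides have full information. The entanglement number $\mathrm{ent}(G)$ is the minimal integer $k$ such that $k$ cops have a strategy to catch the robber on $G$. *)

theory Defs
  imports Main "Graph_Theory.Digraph"
begin

text \<open>
  Finite simple undirected graphs are the symmetric digraphs of locale \<^locale>\<open>graph\<close>: an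
  undirected edge is a pair of opposite arcs, so the degree of a vertex is its out-degree.
\<close>

definition regular_graph :: "nat \<Rightarrow> ('a, 'b) pre_digraph \<Rightarrow> bool" where
  "regular_graph d G \<longleftrightarrow> (\<forall>v \<in> verts G. out_degree G v = d)"

text \<open>
  A strategy for the cops maps the list of all positions the robber has held so far, from his
  starting vertex to his current one, to a move: \<^const>\<open>None\<close> if all cops stay, or
  \<open>Some i\<close> if cop \<open>i\<close> flies to the robber. This amounts to full information, since the
  earlier moves of the cops are determined by the strategy and the robber's walk.
\<close>

type_synonym 'a cop_strategy = "'a list \<Rightarrow> nat option"

definition strategy_for :: "nat \<Rightarrow> 'a cop_strategy \<Rightarrow> bool" where
  "strategy_for k \<sigma> \<longleftrightarrow> (\<forall>h i. \<sigma> h = Some i \<longrightarrow> i < k)"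

text \<open>
  \<open>cop_positions \<sigma> r t i\<close> is the position of cop \<open>i\<close> after the first \<open>t\<close> moves of the cops
  against a robber who is at \<open>r s\<close> before turn \<open>s\<close>; \<^const>\<open>None\<close> means outside the graph.
\<close>

primrec cop_positions :: "'a cop_strategy \<Rightarrow> (nat \<Rightarrow> 'a) \<Rightarrow> nat \<Rightarrow> nat \<Rightarrow> 'a option" where
  "cop_positions \<sigma> r 0 = (\<lambda>i. None)"
| "cop_positions \<sigma> r (Suc t) =
     (case \<sigma> (map r [0..<Suc t]) of
        None \<Rightarrow> cop_positions \<sigma> r t
      | Some i \<Rightarrow> (cop_positions \<sigma> r t)(i := Some (r t)))"

definition robber_escapes ::
    "('a, 'b) pre_digraph \<Rightarrow> 'a cop_strategy \<Rightarrow> (nat \<Rightarrow> 'a) \<Rightarrow> bool" where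
  "robber_escapes G \<sigma> r \<longleftrightarrow>
     r 0 \<in> verts G \<and>
     (\<forall>t. r t \<rightarrow>\<^bsub>G\<^esub> r (Suc t) \<and> (\<forall>i. cop_positions \<sigma> r (Suc t) i \<noteq> Some (r (Suc t))))"

definition cops_win :: "('a, 'b) pre_digraph \<Rightarrow> nat \<Rightarrow> bool" where
  "cops_win G k \<longleftrightarrow> (\<exists>\<sigma>. strategy_for k \<sigma> \<and> (\<nexists>r. robber_escapes G \<sigma> r))"

definition ent :: "('a, 'b) pre_digraph \<Rightarrow> nat" where
  "ent G = (LEAST k. cops_win G k)"

end

theory Submission
  imports Defs
begin

text \<open>
  Call \<open>2e(Z) - 2|Z|\<close> the excess of a vertex set \<open>Z\<close>; it is monotone on the nonempty subsets of a
  connected set. Let the robber be confined by permanent cops to a connected territory \<open>T\<^sub>0\<close>, and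
  call \<open>v \<in> T\<^sub>0\<close> good if its three neighbours lie in one component \<open>Z\<close> of \<open>T\<^sub>0 - {v}\<close>. A permanent
  cop on a good vertex confines the robber to \<open>Z\<close>, whose excess is smaller by at least 4. The excess
  starts at most at \<open>n\<close> and never drops below \<open>-2\<close>, so at most \<open>(n + 2) div 4\<close> permanent cops are
  used. Three more cops force the robber onto a good vertex or catch him: they chase him
  so that his current region is always entered by at most two edges from the part of \<open>T\<^sub>0\<close> behind
  him, and a third edge could only appear when he stands on a good vertex.
\<close>

section \<open>From winning positions to strategies\<close>

text \<open>
  Only the set of vertices known to be guarded is recorded: the cops may forget guards, so that a
  move leads to any \<open>C' \<subseteq> insert v C\<close> with at most \<open>k\<close> elements.
\<close>

inductive cops_catch :: "('a, 'b) pre_digraph \<Rightarrow> nat \<Rightarrow> 'a set \<Rightarrow> 'a \<Rightarrow> bool"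
  for G :: "('a, 'b) pre_digraph" and k :: nat where
  cops_catchI: "\<lbrakk>C' \<subseteq> insert v C; finite C'; card C' \<le> k;
      \<And>w. v \<rightarrow>\<^bsub>G\<^esub> w \<Longrightarrow> w \<notin> C' \<Longrightarrow> cops_catch G k C' w\<rbrakk> \<Longrightarrow> cops_catch G k C v"

lemma cops_catch_mono:
  assumes "cops_catch G k C v" and "C \<subseteq> D"
  shows "cops_catch G k D v"
  using assms by cases (blast intro: cops_catchI)

section \<open>Realising guarded vertex sets by actual cops and strategies\<close>

definition fly :: "(nat \<Rightarrow> 'a option) \<Rightarrow> nat option \<Rightarrow> 'a \<Rightarrow> nat \<Rightarrow> 'a option" where
  "fly c m v = (case m of None \<Rightarrow> c | Some i \<Rightarrow> c(i := Some v))"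

definition covers :: "nat \<Rightarrow> (nat \<Rightarrow> 'a option) \<Rightarrow> 'a set \<Rightarrow> bool" where
  "covers k c C \<longleftrightarrow> (\<forall>x\<in>C. \<exists>i<k. c i = Some x)"

text \<open>If \<open>v\<close> is to be guarded, the other vertices of \<open>C'\<close> occupy at
  most \<open>k - 1\<close> cops, so one is free to fly to \<open>v\<close>; otherwise all cops
  stay.\<close>

lemma covers_fly:
  assumes "covers k c C" "C' \<subseteq> insert v C" "finite C'" "card C' \<le> k"
  obtains m where "\<And>i. m = Some i \<Longrightarrow> i < k" and "covers k (fly c m v) C'"
proof (cases "v \<in> C'")
  case False
  then have "covers k (fly c None v) C'"
    using assms by (auto simp: covers_def fly_def)
  then show ?thesis by (rule that[rotated]) simp
next
  case True
  obtain f where f: "\<And>x. x \<in> C' - {v} \<Longrightarrow> f x < k \<and> c (f x) = Some x"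
    using assms(1,2) unfolding covers_def by (metis Diff_iff insert_iff subsetD)
  have "card (f ` (C' - {v})) < card {..<k}"
    using card_image_le[of "C' - {v}" f] assms(3,4) True card_Diff1_less[of C' v] by simp
  moreover have "f ` (C' - {v}) \<subseteq> {..<k}" using f by auto
  ultimately obtain i where i: "i < k" "i \<notin> f ` (C' - {v})"
    by (metis lessThan_iff less_irrefl subsetI subset_antisym)
  have "covers k (fly c (Some i) v) C'"
    unfolding covers_def fly_def
  proof
    fix x assume "x \<in> C'"
    then show "\<exists>j<k. (case Some i of None \<Rightarrow> c | Some i \<Rightarrow> c(i := Some v)) j = Some x"
      using i f[of x] by (cases "x = v") auto
  qed
  then show ?thesis using i(1) by (intro that[of "Some i"]) auto
qed

text \<open>Generalises \<open>cop_positions\<close> to arbitrary initial positions, so that what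
  follows the first turn is again a play of the same kind.\<close>

primrec positions_from ::
    "(nat \<Rightarrow> 'a option) \<Rightarrow> 'a cop_strategy \<Rightarrow> (nat \<Rightarrow> 'a) \<Rightarrow> nat \<Rightarrow> nat \<Rightarrow> 'a option" where
  "positions_from c \<sigma> r 0 = c"
| "positions_from c \<sigma> r (Suc t) = fly (positions_from c \<sigma> r t) (\<sigma> (map r [0..<Suc t])) (r t)"

lemma cop_positions_eq: "cop_positions \<sigma> r t = positions_from (\<lambda>_. None) \<sigma> r t"
  by (induction t) (simp_all add: fly_def fun_eq_iff split: option.split)

lemma positions_from_cong:
  assumes "\<And>s. s < t \<Longrightarrow> \<sigma> (map r [0..<Suc s]) = \<tau> (map r [0..<Suc s])"
  shows "positions_from c \<sigma> r t = positions_from c \<tau> r t"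
  using assms by (induction t) (simp_all del: upt_Suc)

lemma map_upt_Suc_shift: "map r [0..<Suc t] = r 0 # map (r \<circ> Suc) [0..<t]"
  by (simp del: upt_Suc add: upt_conv_Cons flip: map_Suc_upt)

lemma positions_from_shift:
  "positions_from c \<sigma> r (Suc t) =
    positions_from (fly c (\<sigma> [r 0]) (r 0)) (\<lambda>h. \<sigma> (r 0 # h)) (r \<circ> Suc) t"
proof (induction t)
  case 0
  show ?case by simp
next
  case (Suc t)
  show ?case
    unfolding positions_from.simps(2)[of c \<sigma> r "Suc t"] Suc.IH map_upt_Suc_shift[of r "Suc t"]
    by (simp only: positions_from.simps comp_def)
qed

definition escapes_from ::
    "('a, 'b) pre_digraph \<Rightarrow> (nat \<Rightarrow> 'a option) \<Rightarrow> 'a cop_strategy \<Rightarrow> (nat \<Rightarrow> 'a) \<Rightarrow> bool" where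
  "escapes_from G c \<sigma> r \<longleftrightarrow>
    (\<forall>t. r t \<rightarrow>\<^bsub>G\<^esub> r (Suc t) \<and> (\<forall>i. positions_from c \<sigma> r (Suc t) i \<noteq> Some (r (Suc t))))"

text \<open>The first move comes from \<open>covers_fly\<close>; afterwards the strategy given by
  the induction hypothesis for the robber's next vertex takes over.\<close>

lemma catching_strategy:
  assumes "cops_catch G k C v" and "covers k c C"
  shows "\<exists>\<sigma>. strategy_for k \<sigma> \<and> (\<forall>r. r 0 = v \<longrightarrow> \<not> escapes_from G c \<sigma> r)"
  using assms
proof (induction arbitrary: c)
  case (cops_catchI C' v C)
  obtain m where m: "\<And>i. m = Some i \<Longrightarrow> i < k" "covers k (fly c m v) C'"
    using covers_fly cops_catchI.prems cops_catchI.hyps(1-3) by metis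
  \<comment> \<open>Stated for every \<open>w\<close> to allow choosing a total function; vertices
    the robber cannot move to get the strategy of never flying.\<close>
  have "\<exists>\<tau>. strategy_for k \<tau> \<and> (\<forall>r. r 0 = w \<longrightarrow> v \<rightarrow>\<^bsub>G\<^esub> w \<longrightarrow> w \<notin> C' \<longrightarrow>
      \<not> escapes_from G (fly c m v) \<tau> r)" for w
  proof (cases "v \<rightarrow>\<^bsub>G\<^esub> w \<and> w \<notin> C'")
    case True
    then show ?thesis using cops_catchI.IH m(2) by blast
  next
    case False
    have "strategy_for k (\<lambda>_. None)" by (simp add: strategy_for_def)
    then show ?thesis using False by blast
  qed
  then obtain \<tau> where \<tau>: "\<And>w. strategy_for k (\<tau> w)"
    "\<And>w r. \<lbrakk>r 0 = w; v \<rightarrow>\<^bsub>G\<^esub> w; w \<notin> C'\<rbrakk> \<Longrightarrow> \<not> escapes_from G (fly c m v) (\<tau> w) r"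
    by metis
  \<comment> \<open>An empty tail means the first turn. Later the starting vertex is dropped, since
    \<open>\<tau> w\<close> regards the play as beginning at \<open>w\<close>.\<close>
  define \<sigma> where "\<sigma> = (\<lambda>h. if tl h = [] then m else \<tau> (hd (tl h)) (tl h))"
  have "strategy_for k \<sigma>"
    using m(1) \<tau>(1) by (auto simp: strategy_for_def \<sigma>_def)
  moreover have "\<not> escapes_from G c \<sigma> r" if r: "r 0 = v" for r
  proof
    assume esc: "escapes_from G c \<sigma> r"
    have pos: "positions_from c \<sigma> r (Suc t) = positions_from (fly c m v) (\<tau> (r 1)) (r \<circ> Suc) t" for t
    proof -
      have "positions_from c \<sigma> r (Suc t) =
          positions_from (fly c m v) (\<lambda>h. \<sigma> (r 0 # h)) (r \<circ> Suc) t"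
        unfolding positions_from_shift by (simp add: \<sigma>_def r)
      also have "\<dots> = positions_from (fly c m v) (\<tau> (r 1)) (r \<circ> Suc) t"
        by (rule positions_from_cong) (simp add: \<sigma>_def map_upt_Suc_shift del: upt_Suc)
      finally show ?thesis .
    qed
    have "v \<rightarrow>\<^bsub>G\<^esub> r 1"
      using esc r unfolding escapes_from_def by (metis One_nat_def)
    moreover have "fly c m v i \<noteq> Some (r 1)" for i
      using esc pos[of 0] unfolding escapes_from_def by (metis One_nat_def positions_from.simps(1))
    then have "r 1 \<notin> C'" using m(2) unfolding covers_def by blast
    moreover have "escapes_from G (fly c m v) (\<tau> (r 1)) (r \<circ> Suc)"
      unfolding escapes_from_def
    proof (intro allI conjI)
      fix t i
      show "(r \<circ> Suc) t \<rightarrow>\<^bsub>G\<^esub> (r \<circ> Suc) (Suc t)"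
        using esc unfolding escapes_from_def by simp
      show "positions_from (fly c m v) (\<tau> (r 1)) (r \<circ> Suc) (Suc t) i \<noteq> Some ((r \<circ> Suc) (Suc t))"
        using esc unfolding escapes_from_def pos[symmetric] by (metis comp_apply)
    qed
    ultimately show False using \<tau>(2)[of "r \<circ> Suc" "r 1"] by simp
  qed
  ultimately show ?case by blast
qed

text \<open>The robber's start is the head of every history, so strategies for the individual starts
  merge into one.\<close>

lemma cops_winI:
  assumes "\<And>v. v \<in> verts G \<Longrightarrow> cops_catch G k {} v"
  shows "cops_win G k"
proof -
  have "\<exists>\<tau>. strategy_for k \<tau> \<and>
      (\<forall>r. r 0 = v \<longrightarrow> v \<in> verts G \<longrightarrow> \<not> escapes_from G (\<lambda>_. None) \<tau> r)" for v
  proof (cases "v \<in> verts G")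
    case True
    then show ?thesis
      using catching_strategy[OF assms, of v "\<lambda>_. None"] by (auto simp: covers_def)
  next
    case False
    have "strategy_for k (\<lambda>_. None)" by (simp add: strategy_for_def)
    then show ?thesis using False by blast
  qed
  then obtain \<tau> where \<tau>: "\<And>v. strategy_for k (\<tau> v)"
    "\<And>v r. \<lbrakk>r 0 = v; v \<in> verts G\<rbrakk> \<Longrightarrow> \<not> escapes_from G (\<lambda>_. None) (\<tau> v) r"
    by metis
  define \<sigma> where "\<sigma> = (\<lambda>h. \<tau> (hd h) h)"
  have "strategy_for k \<sigma>" using \<tau>(1) by (auto simp: strategy_for_def \<sigma>_def)
  moreover have "\<not> robber_escapes G \<sigma> r" for r
  proof
    assume esc: "robber_escapes G \<sigma> r"
    have "positions_from (\<lambda>_. None) \<sigma> r t = positions_from (\<lambda>_. None) (\<tau> (r 0)) r t" for t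
      by (rule positions_from_cong) (simp add: \<sigma>_def map_upt_Suc_shift del: upt_Suc)
    then have "escapes_from G (\<lambda>_. None) (\<tau> (r 0)) r" "r 0 \<in> verts G"
      using esc unfolding robber_escapes_def escapes_from_def cop_positions_eq by metis+
    then show False using \<tau>(2) by blast
  qed
  ultimately show ?thesis unfolding cops_win_def by blast
qed

section \<open>Connected sets and excess\<close>

context graph
begin

text \<open>\<open>rtrancl_on\<close> keeps even the empty path inside \<open>S\<close>, so being
  linked includes membership of both ends in \<open>S\<close>.\<close>

abbreviation linked :: "'a set \<Rightarrow> 'a \<Rightarrow> 'a \<Rightarrow> bool" where
  "linked S x y \<equiv> (x, y) \<in> rtrancl_on S (arcs_ends G)"

abbreviation component :: "'a set \<Rightarrow> 'a \<Rightarrow> 'a set" where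
  "component S x \<equiv> {y. linked S x y}"

definition connected_set :: "'a set \<Rightarrow> bool" where
  "connected_set S \<longleftrightarrow> (\<forall>x\<in>S. \<forall>y\<in>S. linked S x y)"

lemma dominates_sym: "u \<rightarrow> v \<Longrightarrow> v \<rightarrow> u"
  using sym_arcs by (rule arcs_ends_symmetric)

lemma linked_sym: "linked S x y \<Longrightarrow> linked S y x"
  using sym_arcs unfolding symmetric_def by (blast dest: rtrancl_on_sym symD)

lemma linked_mono: "linked S x y \<Longrightarrow> S \<subseteq> T \<Longrightarrow> linked T x y"
  by (rule rtrancl_on_mono[OF order_refl])

lemma linked_arc: "x \<rightarrow> y \<Longrightarrow> x \<in> S \<Longrightarrow> y \<in> S \<Longrightarrow> linked S x y"
  by (blast intro: rtrancl_on_into_rtrancl_on rtrancl_on_refl)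

lemma component_subset: "component S x \<subseteq> S"
  by (auto dest: in_rtrancl_on_in_F)

lemma component_closed: "u \<in> component S x \<Longrightarrow> u \<rightarrow> w \<Longrightarrow> w \<in> S \<Longrightarrow> w \<in> component S x"
  by (auto intro: rtrancl_on_into_rtrancl_on)

text \<open>Every vertex on a path from \<open>x\<close> is itself linked to \<open>x\<close>, so
  the path stays in the component.\<close>

lemma linked_in_component: "linked S x y \<Longrightarrow> linked (component S x) x y"
proof (induction rule: rtrancl_on_induct)
  case base
  then show ?case by (intro rtrancl_on_refl) auto
next
  case (step y z)
  then show ?case
    by (intro rtrancl_on_into_rtrancl_on[OF step.IH]) (auto intro: rtrancl_on_into_rtrancl_on)
qed

lemma connected_component: "connected_set (component S x)"
  unfolding connected_set_def
  by (blast intro: linked_in_component linked_sym rtrancl_on_trans)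

text \<open>Ordered pairs count every edge twice. The value is an integer because trees have excess
  -2.\<close>

definition excess :: "'a set \<Rightarrow> int" where
  "excess Z = int (card {(x, y). x \<in> Z \<and> y \<in> Z \<and> x \<rightarrow> y}) - 2 * int (card Z)"

lemma excess_insert:
  assumes "finite Z" "u \<notin> Z"
  shows "excess (insert u Z) = excess Z + 2 * int (card {w \<in> Z. u \<rightarrow> w}) - 2"
proof -
  let ?E = "{(x, y). x \<in> Z \<and> y \<in> Z \<and> x \<rightarrow> y}" and ?N = "{w \<in> Z. u \<rightarrow> w}"
  have eq: "{(x, y). x \<in> insert u Z \<and> y \<in> insert u Z \<and> x \<rightarrow> y} = ?E \<union> ({u} \<times> ?N \<union> ?N \<times> {u})"
    using adj_not_same dominates_sym by auto
  have finE: "finite ?E" by (rule finite_subset[of _ "Z \<times> Z"]) (use assms in auto)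
  have "card (?E \<union> ({u} \<times> ?N \<union> ?N \<times> {u})) = card ?E + card ({u} \<times> ?N \<union> ?N \<times> {u})"
    by (rule card_Un_disjoint) (use assms finE in auto)
  also have "card ({u} \<times> ?N \<union> ?N \<times> {u}) = card ({u} \<times> ?N) + card (?N \<times> {u})"
    by (rule card_Un_disjoint) (use assms in auto)
  finally show ?thesis
    unfolding excess_def eq using assms by (simp add: card_cartesian_product)
qed

lemma linked_leaves:
  assumes "linked T x y" "x \<in> Z" "y \<notin> Z"
  obtains a b where "a \<in> Z" "b \<in> T - Z" "a \<rightarrow> b"
proof -
  have "\<exists>a\<in>Z. \<exists>b\<in>T - Z. a \<rightarrow> b"
    using assms by (induction rule: rtrancl_on_induct) auto
  then show ?thesis using that by blast
qed

text \<open>As long as \<open>Z\<close> differs from \<open>T\<close>, some vertex of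
  \<open>T - Z\<close> is adjacent to \<open>Z\<close>; adding it changes the excess by at least 2 -
  2 = 0.\<close>

lemma excess_mono:
  assumes "finite T" "connected_set T" "Z \<subseteq> T" "Z \<noteq> {}"
  shows "excess Z \<le> excess T"
  using assms(3,4)
proof (induction "card (T - Z)" arbitrary: Z rule: less_induct)
  case less
  show ?case
  proof (cases "Z = T")
    case False
    then obtain x y where "x \<in> Z" "y \<in> T" "y \<notin> Z" using less.prems by blast
    then obtain a b where ab: "a \<in> Z" "b \<in> T - Z" "a \<rightarrow> b"
      using assms(2) less.prems linked_leaves unfolding connected_set_def by (metis subsetD)
    have fin: "finite Z" using less.prems assms(1) finite_subset by blast
    have "card {w \<in> Z. b \<rightarrow> w} > 0"
      using ab fin dominates_sym by (auto simp: card_gt_0_iff)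
    then have "excess Z \<le> excess (insert b Z)"
      using excess_insert[OF fin, of b] ab by simp
    also have "card (T - insert b Z) < card (T - Z)"
      using ab assms(1) by (intro psubset_card_mono) auto
    then have "excess (insert b Z) \<le> excess T"
      using less.hyps less.prems ab by auto
    finally show ?thesis .
  qed simp
qed

lemma excess_singleton: "excess {x} = -2"
proof -
  have "excess {} = 0" by (simp add: excess_def)
  then show ?thesis using excess_insert[of "{}" x] by simp
qed

lemma card_neighbours: "card {w. v \<rightarrow> w} = out_degree G v"
proof -
  have "{w. v \<rightarrow> w} = head G ` out_arcs G v"
    unfolding arcs_ends_conv out_arcs_def by blast
  moreover have "inj_on (head G) (out_arcs G v)"
    by (rule inj_onI) (rule no_multi_arcs, simp_all add: arc_to_ends_def)
  ultimately show ?thesis by (simp add: card_image out_degree_def)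
qed

end

section \<open>The chase\<close>

locale cubic_graph = graph +
  assumes regular: "regular_graph 3 G"
begin

lemma card_neighbours_3: "v \<in> verts G \<Longrightarrow> card {w. v \<rightarrow> w} = 3"
  using regular by (simp add: card_neighbours regular_graph_def)

lemma neighbours_two_known:
  assumes "v \<rightarrow> x" "v \<rightarrow> y" "x \<noteq> y"
  obtains z where "{w. v \<rightarrow> w} = {x, y, z}"
proof -
  have 3: "card {w. v \<rightarrow> w} = 3" using assms(1) card_neighbours_3 adj_in_verts by blast
  then have fin: "finite {w. v \<rightarrow> w}" by (metis card.infinite zero_neq_numeral)
  have "card ({w. v \<rightarrow> w} - {x, y}) = 1"
    using assms 3 fin by (subst card_Diff_subset) auto
  then obtain z where "{w. v \<rightarrow> w} - {x, y} = {z}" by (auto simp: card_1_singleton_iff)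
  then have "{w. v \<rightarrow> w} = {x, y, z}" using assms by blast
  then show ?thesis by (rule that)
qed

lemma neighbours_one_known:
  assumes "v \<rightarrow> x"
  obtains y z where "{w. v \<rightarrow> w} = {x, y, z}"
proof -
  have "card {w. v \<rightarrow> w} = 3" using assms card_neighbours_3 adj_in_verts by blast
  then have "\<not> {w. v \<rightarrow> w} \<subseteq> {x}"
    using card_mono[of "{x}" "{w. v \<rightarrow> w}"] by auto
  then obtain y where "v \<rightarrow> y" "x \<noteq> y" by blast
  then show ?thesis using neighbours_two_known[OF assms] that by metis
qed

definition good :: "'a set \<Rightarrow> 'a \<Rightarrow> bool" where
  "good T v \<longleftrightarrow> v \<in> T \<and> (\<exists>x. {w. v \<rightarrow> w} \<subseteq> component (T - {v}) x)"

text \<open>Putting \<open>v\<close> back into \<open>Z\<close> adds three edges and one vertex,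
  hence 6 - 2 = 4; then \<open>excess_mono\<close> applies.\<close>

lemma excess_good:
  assumes "finite T" "connected_set T" "v \<in> T" "{w. v \<rightarrow> w} \<subseteq> Z" "Z \<subseteq> T - {v}" "v \<in> verts G"
  shows "excess Z + 4 \<le> excess T"
proof -
  have fin: "finite Z" using assms(1,5) finite_subset by blast
  have vZ: "v \<notin> Z" using assms(5) by blast
  have "{w \<in> Z. v \<rightarrow> w} = {w. v \<rightarrow> w}" using assms(4) by blast
  then have "excess (insert v Z) = excess Z + 4"
    using excess_insert[OF fin vZ] card_neighbours_3[OF assms(6)] by simp
  moreover have "excess (insert v Z) \<le> excess T"
    using assms by (intro excess_mono) auto
  ultimately show ?thesis by simp
qed

text \<open>
  The robber at \<open>v\<close> has just come from \<open>b\<close>, and \<open>T\<close> can be entered from the rest of \<open>T\<^sub>0\<close> only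
  through the guarded arcs \<open>b \<rightarrow> v\<close> and \<open>c \<rightarrow> y\<close>, which are allowed to coincide.
\<close>

lemma chase:
  assumes P: "finite P" "card P + 3 \<le> k"
    and closed: "\<And>u w. u \<in> T\<^sub>0 \<Longrightarrow> u \<rightarrow> w \<Longrightarrow> w \<in> T\<^sub>0 \<union> P"
    and good: "\<And>u. good T\<^sub>0 u \<Longrightarrow> cops_catch G k P u"
    and T: "finite T" "T \<subseteq> T\<^sub>0" "v \<in> T" "y \<in> T" "b \<rightarrow> v" "c \<rightarrow> y" "linked (T\<^sub>0 - T) b c"
    and entry: "\<And>q u. \<lbrakk>q \<in> T\<^sub>0 - T; u \<in> T; q \<rightarrow> u\<rbrakk> \<Longrightarrow> (q, u) = (b, v) \<or> (q, u) = (c, y)"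
  shows "cops_catch G k (P \<union> {b, c}) v"
  using T entry
proof (induction "card T" arbitrary: T v y b c rule: less_induct)
  case less
  note entry = less.prems(8)
  show ?case
  proof (cases "good T\<^sub>0 v")
    case True
    \<comment> \<open>On a good vertex the chase ends, and the guards on \<open>b\<close> and
      \<open>c\<close> are released.\<close>
    show ?thesis by (rule cops_catch_mono[OF good[OF True]]) blast
  next
    case not_good: False
    have bc: "b \<in> T\<^sub>0 - T" "c \<in> T\<^sub>0 - T" using less.prems(7) in_rtrancl_on_in_F by metis+
    show ?thesis
    proof (rule cops_catchI)
      show "P \<union> {b, c, v} \<subseteq> insert v (P \<union> {b, c})" by blast
      show "finite (P \<union> {b, c, v})" using P by simp
      have "card {b, c, v} \<le> 3" by (simp add: card_insert_if)
      then show "card (P \<union> {b, c, v}) \<le> k"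
        using P card_Un_le[of P "{b, c, v}"] by linarith
    next
      fix x assume x: "v \<rightarrow> x" "x \<notin> P \<union> {b, c, v}"
      have vT: "v \<in> T\<^sub>0" using less.prems by blast
      \<comment> \<open>An exit from \<open>T\<^sub>0\<close> leads into \<open>P\<close>, and an
        exit from \<open>T\<close> to the rest of \<open>T\<^sub>0\<close> reverses an entry arc, so
        it ends in \<open>b\<close> or \<open>c\<close>; all of these are guarded.\<close>
      have xT: "x \<in> T"
      proof (rule ccontr)
        assume "x \<notin> T"
        then have "x \<in> T\<^sub>0 - T" using closed[OF vT x(1)] x(2) by blast
        then show False using entry[of x v] less.prems(3) dominates_sym[OF x(1)] x(2) by blast
      qed
      obtain z where nbrs: "{w. v \<rightarrow> w} = {b, x, z}"
        using neighbours_two_known[of v b x] x dominates_sym[OF less.prems(5)] by blast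
      define T' where "T' = component (T - {v}) x"
      have T': "T' \<subseteq> T - {v}" unfolding T'_def by (rule component_subset)
      have xT': "x \<in> T'" unfolding T'_def using xT x(2) by auto
      have card': "card T' < card T"
        using T' less.prems(1,3) by (intro psubset_card_mono) auto
      have fin': "finite T'" using T' less.prems(1) finite_subset by blast
      have sub': "T' \<subseteq> T\<^sub>0" using T' less.prems(2) by blast
      have v_out: "v \<in> T\<^sub>0 - T'" using vT T' by blast
      \<comment> \<open>The entry at \<open>v\<close> vanishes together with \<open>v\<close>; only
        arcs from \<open>v\<close> to \<open>x\<close> or \<open>z\<close> and possibly
        \<open>c \<rightarrow> y\<close> remain.\<close>
      have entry': "q = v \<and> (u = x \<or> u = z) \<or> (q, u) = (c, y)"
        if "q \<in> T\<^sub>0 - T'" "u \<in> T'" "q \<rightarrow> u" for q u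
      proof (cases "q \<in> T")
        case True
        have "q = v"
        proof (rule ccontr)
          assume "q \<noteq> v"
          then have "q \<in> T'" unfolding T'_def
            using component_closed[of u x "T - {v}" q] that True dominates_sym
            unfolding T'_def by blast
          then show False using that by blast
        qed
        moreover have "u \<noteq> b" using that T' bc by blast
        ultimately show ?thesis using nbrs that(3) by blast
      next
        case False
        then show ?thesis using entry[of q u] that T' by blast
      qed
      have linked_bc: "linked (T\<^sub>0 - T') b c"
        using less.prems(7) by (rule linked_mono) (use T' in blast)
      \<comment> \<open>The cases record which of the entries at \<open>y\<close> and
        \<open>z\<close> survive besides the one at \<open>x\<close>.\<close>
      consider (two) "y \<notin> T'" "z \<in> T'" "v \<rightarrow> z" | (one) "y \<notin> T'" "z \<notin> T'"
        | (other) "y \<in> T'" "z \<notin> T'" | (three) "y \<in> T'" "z \<in> T'" "v \<rightarrow> z"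
        using nbrs by blast
      then have "cops_catch G k (P \<union> {v, v}) x \<or> cops_catch G k (P \<union> {v, c}) x"
      proof cases
        case two
        have "cops_catch G k (P \<union> {v, v}) x"
        proof (rule less.hyps[OF card' fin' sub' xT' two(2) x(1) two(3)])
          show "linked (T\<^sub>0 - T') v v" using v_out by simp
          show "(q, u) = (v, x) \<or> (q, u) = (v, z)" if "q \<in> T\<^sub>0 - T'" "u \<in> T'" "q \<rightarrow> u" for q u
            using entry'[OF that] two(1) that by blast
        qed
        then show ?thesis ..
      next
        case one
        \<comment> \<open>With a single entry left, both guarded arcs are taken to be
          \<open>v \<rightarrow> x\<close>.\<close>
        have "cops_catch G k (P \<union> {v, v}) x"
        proof (rule less.hyps[OF card' fin' sub' xT' xT' x(1) x(1)])
          show "linked (T\<^sub>0 - T') v v" using v_out by simp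
          show "(q, u) = (v, x) \<or> (q, u) = (v, x)" if "q \<in> T\<^sub>0 - T'" "u \<in> T'" "q \<rightarrow> u" for q u
            using entry'[OF that] one that by blast
        qed
        then show ?thesis ..
      next
        case other
        have "cops_catch G k (P \<union> {v, c}) x"
        proof (rule less.hyps[OF card' fin' sub' xT' other(1) x(1) less.prems(6)])
          \<comment> \<open>The arc from \<open>v\<close> back to \<open>b\<close> extends the old
            link from \<open>b\<close> to \<open>c\<close>, which preserves the invariant.\<close>
          have "b \<in> T\<^sub>0 - T'" using bc T' by blast
          then have "linked (T\<^sub>0 - T') v b"
            by (rule linked_arc[OF dominates_sym[OF less.prems(5)] v_out])
          then show "linked (T\<^sub>0 - T') v c" using linked_bc by (rule rtrancl_on_trans)
          show "(q, u) = (v, x) \<or> (q, u) = (c, y)" if "q \<in> T\<^sub>0 - T'" "u \<in> T'" "q \<rightarrow> u" for q u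
            using entry'[OF that] other that by blast
        qed
        then show ?thesis ..
      next
        case three
        \<comment> \<open>Three entries are impossible: from \<open>x\<close> via \<open>y\<close>
          to \<open>c\<close>, then behind the region to \<open>b\<close>, there is a path avoiding
          \<open>v\<close>. So \<open>b\<close>, \<open>x\<close> and \<open>z\<close> lie in one
          component and \<open>v\<close> would be good.\<close>
        have sub: "T - {v} \<subseteq> T\<^sub>0 - {v}" "T\<^sub>0 - T \<subseteq> T\<^sub>0 - {v}" using less.prems(2,3) by blast+
        have xy: "linked (T\<^sub>0 - {v}) x y" and xz: "linked (T\<^sub>0 - {v}) x z"
          using three linked_mono[OF _ sub(1)] unfolding T'_def by simp_all
        have "y \<in> T\<^sub>0 - {v}" "c \<in> T\<^sub>0 - {v}" using three(1) T' bc sub by blast+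
        then have yc: "linked (T\<^sub>0 - {v}) y c"
          by (rule linked_arc[OF dominates_sym[OF less.prems(6)]])
        have cb: "linked (T\<^sub>0 - {v}) c b"
          using linked_mono[OF linked_sym[OF less.prems(7)] sub(2)] .
        have "linked (T\<^sub>0 - {v}) x b"
          by (rule rtrancl_on_trans[OF rtrancl_on_trans[OF xy yc] cb])
        moreover have "linked (T\<^sub>0 - {v}) x x"
          by (rule rtrancl_on_refl) (use xT' T' sub(1) in blast)
        ultimately have "{w. v \<rightarrow> w} \<subseteq> component (T\<^sub>0 - {v}) x" unfolding nbrs using xz by simp
        then show ?thesis using not_good vT unfolding good_def by metis
      qed
      then show "cops_catch G k (P \<union> {b, c, v}) x"
        by (rule disjE) (erule cops_catch_mono, blast)+
    qed
  qed
qed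

text \<open>Once a first vertex \<open>v\<close> is guarded, the robber's region is entered only
  from \<open>v\<close>, by at most two arcs unless \<open>v\<close> is good; so
  \<open>chase\<close> applies with \<open>b\<close> and \<open>c\<close> both equal to
  \<open>v\<close>.\<close>

lemma catch_in_territory_step:
  assumes P: "finite P" "card P + 3 \<le> k"
    and T: "finite T\<^sub>0" "v \<in> T\<^sub>0"
    and closed: "\<And>u w. u \<in> T\<^sub>0 \<Longrightarrow> u \<rightarrow> w \<Longrightarrow> w \<in> T\<^sub>0 \<union> P"
    and good: "\<And>u. good T\<^sub>0 u \<Longrightarrow> cops_catch G k P u"
  shows "cops_catch G k P v"
proof (cases "good T\<^sub>0 v")
  case True
  then show ?thesis by (rule good)
next
  case not_good: False
  show ?thesis
  proof (rule cops_catchI)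
    show "insert v P \<subseteq> insert v P" ..
    show "finite (insert v P)" using P by simp
    show "card (insert v P) \<le> k" using P by (simp add: card_insert_if)
  next
    fix x assume x: "v \<rightarrow> x" "x \<notin> insert v P"
    obtain y z where nbrs: "{w. v \<rightarrow> w} = {x, y, z}" using neighbours_one_known[OF x(1)] .
    define T' where "T' = component (T\<^sub>0 - {v}) x"
    have T': "T' \<subseteq> T\<^sub>0 - {v}" unfolding T'_def by (rule component_subset)
    have xT': "x \<in> T'" unfolding T'_def using closed[OF T(2) x(1)] x(2) by auto
    have fin': "finite T'" using T' T(1) finite_subset by blast
    have sub': "T' \<subseteq> T\<^sub>0" using T' by blast
    have entry': "q = v" if "q \<in> T\<^sub>0 - T'" "u \<in> T'" "q \<rightarrow> u" for q u
    proof (rule ccontr)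
      assume "q \<noteq> v"
      then have "q \<in> T'" unfolding T'_def
        using component_closed[of u x "T\<^sub>0 - {v}" q] that dominates_sym unfolding T'_def by blast
      then show False using that(1) by blast
    qed
    have vv: "linked (T\<^sub>0 - T') v v" using T(2) T' by auto
    have "\<not> {x, y, z} \<subseteq> T'"
      using not_good T(2) unfolding good_def nbrs T'_def by blast
    moreover have "v \<rightarrow> y" "v \<rightarrow> z" using nbrs by blast+
    \<comment> \<open>\<open>a\<close> is the possible second entry; it may be \<open>x\<close>
      itself.\<close>
    ultimately obtain a where a: "a \<in> T'" "v \<rightarrow> a" "{x, y, z} \<inter> T' \<subseteq> {x, a}"
      using xT' x(1) by (cases "y \<in> T'"; cases "z \<in> T'") auto
    have "cops_catch G k (P \<union> {v, v}) x"
    proof (rule chase[OF P closed good fin' sub' xT' a(1) x(1) a(2) vv])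
      show "(q, u) = (v, x) \<or> (q, u) = (v, a)" if "q \<in> T\<^sub>0 - T'" "u \<in> T'" "q \<rightarrow> u" for q u
        using entry'[OF that] that nbrs a(3) by blast
    qed
    then show "cops_catch G k (insert v P) x" by simp
  qed
qed

section \<open>Shrinking the territory with permanent cops\<close>

lemma good_vertex_component:
  assumes "good T u" "T \<subseteq> verts G" "connected_set T"
  obtains Z where "{w. u \<rightarrow> w} \<subseteq> Z" "Z \<subseteq> T - {u}" "connected_set Z"
    "\<forall>s\<in>Z. \<forall>t\<in>T - {u}. s \<rightarrow> t \<longrightarrow> t \<in> Z"
    "-2 \<le> excess Z" "excess Z + 4 \<le> excess T"
proof -
  obtain x where u: "u \<in> T" "{w. u \<rightarrow> w} \<subseteq> component (T - {u}) x"
    using assms(1) unfolding good_def by blast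
  define Z where "Z = component (T - {u}) x"
  have nbrs: "{w. u \<rightarrow> w} \<subseteq> Z" using u(2) unfolding Z_def .
  have sub: "Z \<subseteq> T - {u}" unfolding Z_def by (rule component_subset)
  have conn: "connected_set Z" unfolding Z_def by (rule connected_component)
  have closed: "\<forall>s\<in>Z. \<forall>t\<in>T - {u}. s \<rightarrow> t \<longrightarrow> t \<in> Z"
    unfolding Z_def
  proof (intro ballI impI)
    fix s t assume "s \<in> component (T - {u}) x" "t \<in> T - {u}" "s \<rightarrow> t"
    then show "t \<in> component (T - {u}) x" by (simp add: rtrancl_on_into_rtrancl_on)
  qed
  have uG: "u \<in> verts G" using u(1) assms(2) by blast
  have finT: "finite T" using assms(2) finite_verts by (rule finite_subset)
  have finZ: "finite Z" using sub finT by (blast intro: finite_subset)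
  have "{w. u \<rightarrow> w} \<noteq> {}" using card_neighbours_3[OF uG] by (metis card.empty zero_neq_numeral)
  then obtain w where "w \<in> Z" using nbrs by blast
  then have "excess {w} \<le> excess Z" by (intro excess_mono[OF finZ conn]) simp_all
  then have "-2 \<le> excess Z" by (simp add: excess_singleton)
  then show ?thesis
    by (rule that[OF nbrs sub conn closed _ excess_good[OF finT assms(3) u(1) nbrs sub uG]])
qed

text \<open>\<open>m\<close> counts the permanent cops still available. Each good vertex costs one
  and lowers the excess by at least 4, in step with the bound \<open>4 * int m + 2\<close>.\<close>

lemma catch_in_territory:
  assumes "finite P" "card P + m + 3 \<le> k" "T \<subseteq> verts G" "connected_set T" "v \<in> T"
    and "\<And>u w. u \<in> T \<Longrightarrow> u \<rightarrow> w \<Longrightarrow> w \<in> T \<union> P"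
    and "excess T < 4 * int m + 2"
  shows "cops_catch G k P v"
  using assms
proof (induction m arbitrary: P T v)
  case 0
  show ?case
  proof (rule catch_in_territory_step[OF "0.prems"(1) _ _ "0.prems"(5,6)])
    show "card P + 3 \<le> k" using "0.prems"(2) by simp
    show "finite T" using "0.prems"(3) finite_verts by (rule finite_subset)
    fix u assume "good T u"
    \<comment> \<open>For \<open>m = 0\<close> there is no good vertex: it would force
      \<open>excess T\<close> to be at least -2 + 4 = 2.\<close>
    then obtain Z where "-2 \<le> excess Z" "excess Z + 4 \<le> excess T"
      using "0.prems"(3,4) by (rule good_vertex_component) (rule that)
    then show "cops_catch G k P u" using "0.prems"(7) by simp
  qed
next
  case (Suc m)
  show ?case
  proof (rule catch_in_territory_step[OF Suc.prems(1) _ _ Suc.prems(5,6)])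
    show "card P + 3 \<le> k" using Suc.prems(2) by simp
    show "finite T" using Suc.prems(3) finite_verts by (rule finite_subset)
    fix u assume "good T u"
    then obtain Z where Z: "{w. u \<rightarrow> w} \<subseteq> Z" "Z \<subseteq> T - {u}" "connected_set Z"
      "\<forall>s\<in>Z. \<forall>t\<in>T - {u}. s \<rightarrow> t \<longrightarrow> t \<in> Z" "-2 \<le> excess Z" "excess Z + 4 \<le> excess T"
      using Suc.prems(3,4) by (rule good_vertex_component) (rule that)
    have card: "card (insert u P) \<le> Suc (card P)" using Suc.prems(1) by (simp add: card_insert_if)
    have fin: "finite (insert u P)" using Suc.prems(1) by simp
    show "cops_catch G k P u"
    proof (rule cops_catchI[OF order_refl fin])
      show "card (insert u P) \<le> k" using card Suc.prems(2) by simp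
      fix w assume "u \<rightarrow> w" "w \<notin> insert u P"
      show "cops_catch G k (insert u P) w"
      proof (rule Suc.IH[OF fin _ _ Z(3)])
        show "card (insert u P) + m + 3 \<le> k" using card Suc.prems(2) by simp
        show "Z \<subseteq> verts G" using Z(2) Suc.prems(3) by blast
        show "w \<in> Z" using \<open>u \<rightarrow> w\<close> Z(1) by blast
        show "excess Z < 4 * int m + 2" using Z(6) Suc.prems(7) by simp
        fix s t assume s: "s \<in> Z" "s \<rightarrow> t"
        \<comment> \<open>Within \<open>T\<close>, the only way out of \<open>Z\<close> is to
          \<open>u\<close>, which now carries a permanent cop.\<close>
        then have "t \<in> T \<union> P" using Suc.prems(6) Z(2) by blast
        then show "t \<in> Z \<union> insert u P" using Z(4) s by blast
      qed
    qed
  qed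
qed

text \<open>By regularity 2e(Z) is at most 3|Z|.\<close>

lemma excess_le_card:
  assumes "Z \<subseteq> verts G"
  shows "excess Z \<le> int (card Z)"
proof -
  have fin: "finite Z" using assms finite_verts finite_subset by blast
  have finN: "finite {w. x \<rightarrow> w}" if "x \<in> Z" for x
    using card_neighbours_3[of x] assms that by (metis card.infinite subsetD zero_neq_numeral)
  have "card {(x, y). x \<in> Z \<and> y \<in> Z \<and> x \<rightarrow> y} \<le> card (SIGMA x:Z. {w. x \<rightarrow> w})"
    using fin finN by (intro card_mono finite_SigmaI) auto
  also have "\<dots> = (\<Sum>x\<in>Z. 3)"
  proof -
    have "(\<Sum>x\<in>Z. card {w. x \<rightarrow> w}) = (\<Sum>x\<in>Z. 3)"
      by (rule sum.cong) (use assms card_neighbours_3 in auto)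
    then show ?thesis using fin finN by (subst card_SigmaI) auto
  qed
  finally show ?thesis unfolding excess_def by simp
qed

lemma cubic_cops_win: "cops_win G (card (verts G) div 4 + 4)"
proof (rule cops_winI)
  fix v assume v: "v \<in> verts G"
  let ?T = "component (verts G) v"
  have T: "?T \<subseteq> verts G" by (rule component_subset)
  have "excess ?T \<le> int (card ?T)" by (rule excess_le_card[OF T])
  also have "\<dots> \<le> int (card (verts G))" using T finite_verts by (simp add: card_mono)
  \<comment> \<open>With n the number of vertices, n + 2 is less than
    \<open>4 * ((n + 2) div 4) + 4\<close>.\<close>
  finally have ex: "excess ?T < 4 * int ((card (verts G) + 2) div 4) + 2" by presburger
  show "cops_catch G (card (verts G) div 4 + 4) {} v"
  proof (rule catch_in_territory[OF _ _ T connected_component _ _ ex])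
    \<comment> \<open>Three cops chase, and \<open>(n + 2) div 4\<close> is at most
      \<open>n div 4 + 1\<close>, which accounts for the fourth.\<close>
    show "card {} + (card (verts G) + 2) div 4 + 3 \<le> card (verts G) div 4 + 4" by simp
    show "w \<in> ?T \<union> {}" if "u \<in> ?T" "u \<rightarrow> w" for u w
      using component_closed[OF that] adj_in_verts[OF that(2)] by blast
  qed (use v in auto)
qed

end

text \<open>The winning claim accompanies the bound because a \<open>LEAST\<close> is meaningful
  only if some number of cops wins.\<close>

theorem theorem3:
  fixes G :: "('a, 'b) pre_digraph" and n :: nat
  assumes "graph G"
    and "regular_graph 3 G"
    and "card (verts G) = n"
  shows "cops_win G (n div 4 + 4) \<and> ent G \<le> n div 4 + 4"
proof -
  interpret graph G by fact
  interpret cubic_graph G by unfold_locales fact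
  have "cops_win G (n div 4 + 4)" using cubic_cops_win assms(3) by simp
  then show ?thesis unfolding ent_def by (simp add: Least_le)
qed

end
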